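(* Let $k\ge3$ and let $\mathscr{T}\in\mathbb{R}^{n_1\times l\times n_3\times\cdots\times n_k}$ and $\mathscr{S}\in\mathbb{R}^{l\times n_2\times n_3\times\cdots\times n_k}$ be tensors in the TTD format with core tensors $\mathscr{G}_t$ and $\mathscr{H}_t$, $t=1,\dots,k$, and TT-ranks $\{1,r_1,\dots,r_{k-1},1\}$ and $\{1,s_1,\dots,s_{k-1},1\}$, respectively. Define $\widetilde{\mathscr{G}}_t=\mathscr{G}_t\times_2\mathbf{F}_{n_t}$ and $\widetilde{\mathscr{H}}_t=\mathscr{H}_t\times_2\mathbf{F}_{n_t}$ for $t=3,4,\dots,k$. Then the higher-order tensor-tensor product $\mathscr{T}\star_H\mathscr{S}$ admits a TTD representation with TT-ranks $\{1,r_1s_1,r_2s_2,\dots,r_{k-1}s_{k-1},1\}$ and core tensors $$\mathscr{P}_1(1,j_1,\phi(\alpha_1,\beta_1))=\mathscr{G}_1(1,j_1,\alpha_1),$$ $$\mathscr{P}_2(\phi(\alpha_1,\beta_1),j_2,\phi(\alpha_2,\beta_2))=\sum_{j=1}^{l}\mathscr{G}_2(\alpha_1,j,\alpha_2)\,\mathscr{H}_1(1,j,\beta_1)\,\mathscr{H}_2(\beta_1,j_2,\beta_2),$$ $$\mathscr{P}_t=\widetilde{\mathscr{P}}_t\times_2\mathbf{F}_{n_t}^{-1},\quad t=3,4,\dots,k,$$ where $\phi(\alpha_t,\beta_t)=\alpha_t+(\beta_t-1)r_t$ and, for $\alpha_t=1,\dots,r_t$ and $\beta_t=1,\dots,s_t$,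 $$\widetilde{\mathscr{P}}_t\bigl(\phi(\alpha_{t-1},\beta_{t-1}),j_t,\phi(\alpha_t,\beta_t)\bigr)=\widetilde{\mathscr{G}}_t(\alpha_{t-1},j_t,\alpha_t)\,\widetilde{\mathscr{H}}_t(\beta_{t-1},j_t,\beta_t).$$
   Context: A $k$th-order tensor $\mathscr{X}$ of size $m_1\times\cdots\times m_k$ is in tensor train (TTD) format with cores $\mathscr{C}_t$ of size $\rho_{t-1}\times m_t\times\rho_t$, $\rho_0=\rho_k=1$, and TT-ranks $\{\rho_0,\dots,\rho_k\}$ if $\mathscr{X}(j_1,\dots,j_k)=\sum_{\alpha_0,\dots,\alpha_k}\mathscr{C}_1(\alpha_0,j_1,\alpha_1)\cdots\mathscr{C}_k(\alpha_{k-1},j_k,\alpha_k)$, $\alpha_t=1,\dots,\rho_t$; ranks are not required to be minimal, and cores may be complex. Here $r_0=r_k=s_0=s_k=1$. Mode-$p$ multiplication: $(\mathscr{X}\times_p\mathbf{A})(j_1,\dots,j_{p-1},i,j_{p+1},\dots)=\sum_{j_p}\mathbf{A}(i,j_p)\mathscr{X}(j_1,\dots,j_p,\dots)$. $\mathbf{F}_n\in\mathbb{C}^{n\times n}$ is the discrete Fourier transform matrix $\mathbf{F}_n(p,q)=\frac{1}{\sqrt n}\omega^{(p-1)(q-1)}$, $\omega=\exp(-2\pi i/n)$. Facewise product: $(\mathscr{A}\,\Delta\,\mathscr{B})(:,:,j_3,\dots,j_k)=\mathscr{A}(:,:,j_3,\dots,j_k)\,\mathscr{B}(:,:,j_3,\dots,j_k)$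 (matrix product) for every $(j_3,\dots,j_k)$. Higher-order tensor-tensor product: $\mathscr{T}\star_H\mathscr{S}=(\widetilde{\mathscr{T}}\,\Delta\,\widetilde{\mathscr{S}})\times_3\mathbf{F}_{n_3}^{-1}\times_4\cdots\times_k\mathbf{F}_{n_k}^{-1}$, where $\widetilde{\mathscr{T}}=\mathscr{T}\times_3\mathbf{F}_{n_3}\times_4\cdots\times_k\mathbf{F}_{n_k}$ and $\widetilde{\mathscr{S}}=\mathscr{S}\times_3\mathbf{F}_{n_3}\times_4\cdots\times_k\mathbf{F}_{n_k}$. *)

theory Defs
  imports
    Complex_Main
    "HOL-Library.FuncSet"
    "Jordan_Normal_Form.Determinant"
begin

text \<open>Conventions. All index values start at 0, as for the matrices of
  Jordan_Normal_Form; an index called 1 in the 1-based literature is 0 here.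
  Modes of a tensor are nevertheless numbered 1, ..., k, and so are the cores
  of a tensor train and their ranks, numbered 0, ..., k.\<close>

definition index_set :: "nat list \<Rightarrow> nat list set" where
  "index_set ds = {js. length js = length ds \<and> (\<forall>i<length ds. js ! i < ds ! i)}"

text \<open>A tensor carries its list of sizes. Its entry function is normalised outside the
  index set, so that equality of tensors means equal sizes and equal entries.\<close>

typedef 'a tensor = "{(ds, f :: nat list \<Rightarrow> 'a). f \<in> extensional (index_set ds)}"
  by (rule exI[of _ "([], restrict undefined (index_set []))"]) simp

setup_lifting type_definition_tensor

lift_definition dims :: "'a tensor \<Rightarrow> nat list" is fst .

lift_definition entry :: "'a tensor \<Rightarrow> nat list \<Rightarrow> 'a" is snd .

lift_definition mk_tensor :: "nat list \<Rightarrow> (nat list \<Rightarrow> 'a) \<Rightarrow> 'a tensor" is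
  "\<lambda>ds f. (ds, restrict f (index_set ds))"
  by simp

lemma dims_mk_tensor [simp]: "dims (mk_tensor ds f) = ds"
  by transfer simp

lemma entry_mk_tensor [simp]: "js \<in> index_set ds \<Longrightarrow> entry (mk_tensor ds f) js = f js"
  by transfer simp

lemma tensor_eqI:
  assumes "dims X = dims Y" and "\<And>js. js \<in> index_set (dims X) \<Longrightarrow> entry X js = entry Y js"
  shows "X = Y"
  using assms by transfer (auto intro: extensionalityI)

definition tensor_order :: "'a tensor \<Rightarrow> nat" where
  "tensor_order X = length (dims X)"

definition mode_size :: "'a tensor \<Rightarrow> nat \<Rightarrow> nat" where
  "mode_size X p = dims X ! (p - 1)"

text \<open>The mode-\<open>p\<close> product; mode \<open>p\<close> occupies list position \<open>p - 1\<close>.\<close>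

definition mode_prod :: "'a::comm_semiring_1 tensor \<Rightarrow> nat \<Rightarrow> 'a mat \<Rightarrow> 'a tensor" where
  "mode_prod X p A = mk_tensor ((dims X)[p - 1 := dim_row A])
     (\<lambda>js. \<Sum>j<mode_size X p. A $$ (js ! (p - 1), j) * entry X (js[p - 1 := j]))"

definition dft_mat :: "nat \<Rightarrow> complex mat" where
  "dft_mat n = mat n n (\<lambda>(p, q).
     complex_of_real (1 / sqrt (real n)) * exp (- 2 * complex_of_real pi * \<i> / of_nat n) ^ (p * q))"

definition dft_inv :: "nat \<Rightarrow> complex mat" where
  "dft_inv n = the (mat_inverse (dft_mat n))"

text \<open>The option is never \<open>None\<close>: the lemma \<open>dft_inv\<close> below shows that this is the
  two-sided inverse.\<close>

lemma dft_mat_carrier [simp]: "dft_mat n \<in> carrier_mat n n"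
  by (simp add: dft_mat_def)

lemma dft_mat_right_inverse:
  "dft_mat n * mat n n (\<lambda>(p, q). cnj (dft_mat n $$ (p, q))) = 1\<^sub>m n" (is "_ * ?C = _")
proof (rule eq_matI)
  fix p q assume "p < dim_row (1\<^sub>m n)" "q < dim_col (1\<^sub>m n)"
  then have p: "p < n" and q: "q < n" by simp_all
  define w where "w = (\<lambda>m::nat. cis (- 2 * pi * real m / real n))"
  have w: "exp (- 2 * complex_of_real pi * \<i> / of_nat n) ^ m = w m" for m
    by (simp add: w_def cis_conv_exp exp_of_nat_mult [symmetric] field_simps)
  have F: "dft_mat n $$ (a, b) = complex_of_real (1 / sqrt (real n)) * w (a * b)"
    if "a < n" "b < n" for a b
    using that using w[of "a * b"] by (simp add: dft_mat_def)
  define z where "z = cis (- 2 * pi * (real p - real q) / real n)"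
  have "w (p * j) * cnj (w (j * q)) = z ^ j" for j
    by (simp add: w_def z_def cis_cnj cis_mult DeMoivre algebra_simps diff_divide_distrib)
  then have wz: "w (p * j) * cnj (w (j * q)) = z ^ j" for j .
  let ?c = "complex_of_real (1 / sqrt (real n))"
  have cc: "?c * ?c = 1 / of_nat n"
    by (simp flip: of_real_mult)
  have zj: "dft_mat n $$ (p, j) * cnj (dft_mat n $$ (j, q)) = z ^ j / of_nat n" if "j < n" for j
  proof -
    have "dft_mat n $$ (p, j) * cnj (dft_mat n $$ (j, q)) =
        (?c * w (p * j)) * (?c * cnj (w (j * q)))"
      using F[of p j] F[of j q] that p q by (simp only: complex_cnj_mult complex_cnj_complex_of_real)
    also have "\<dots> = (?c * ?c) * (w (p * j) * cnj (w (j * q)))"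
      by (simp only: ac_simps)
    finally show ?thesis
      by (simp only: cc wz) simp
  qed
  have "(dft_mat n * ?C) $$ (p, q) = (\<Sum>j<n. z ^ j / of_nat n)"
    using p q zj by (simp add: scalar_prod_def dft_mat_def atLeast0LessThan)
  also have "\<dots> = (if p = q then 1 else 0)"
  proof (cases "p = q")
    case True
    then show ?thesis using p by (simp add: z_def)
  next
    case False
    have n: "n > 0" using p by simp
    have "z \<noteq> 1"
    proof
      assume "z = 1"
      then have "Re z = 1" by simp
      then have "cos (- 2 * pi * (real p - real q) / real n) = 1" by (simp only: z_def cis.sel)
      then obtain m :: int where "- 2 * pi * (real p - real q) / real n = of_int m * 2 * pi"
        unfolding cos_one_2pi_int by blast
      then have "2 * pi * (- (real p - real q)) = 2 * pi * (of_int m * real n)"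
        using n by (simp add: field_simps)
      then have "- (real p - real q) = of_int m * real n"
        by (simp only: mult_cancel_left) simp
      then have "real_of_int (int q - int p) = real_of_int (m * int n)" by simp
      then have "int q - int p = m * int n" by (simp only: of_int_eq_iff)
      then have "int n dvd int q - int p" by simp
      then have "int n \<le> \<bar>int q - int p\<bar>"
        using False by (intro zdvd_imp_le) auto
      then show False using p q by linarith
    qed
    moreover have "z ^ n = 1"
    proof -
      have "real n * (- 2 * pi * (real p - real q) / real n) = 2 * pi * of_int (int q - int p)"
        using n by (simp add: field_simps)
      then have "z ^ n = cis (2 * pi * of_int (int q - int p))"
        by (simp only: z_def DeMoivre)
      then show ?thesis by (simp add: cis_multiple_2pi)
    qed
    ultimately show ?thesis
      using False by (simp add: geometric_sum flip: sum_divide_distrib)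
  qed
  finally show "(dft_mat n * ?C) $$ (p, q) = 1\<^sub>m n $$ (p, q)"
    using p q by simp
qed (simp_all add: dft_mat_def)

lemma dft_inv:
  "dft_inv n \<in> carrier_mat n n" "dft_mat n * dft_inv n = 1\<^sub>m n" "dft_inv n * dft_mat n = 1\<^sub>m n"
proof -
  let ?C = "mat n n (\<lambda>(p, q). cnj (dft_mat n $$ (p, q)))"
  have "?C * dft_mat n = 1\<^sub>m n"
    by (rule mat_mult_left_right_inverse[OF dft_mat_carrier _ dft_mat_right_inverse]) simp
  then have "dft_mat n \<in> Units (ring_mat TYPE(complex) n ())"
    using dft_mat_right_inverse[of n] by (auto simp: Units_def ring_mat_def intro!: bexI[of _ ?C])
  then obtain B where "mat_inverse (dft_mat n) = Some B"
    using mat_inverse(1)[OF dft_mat_carrier, where b = "()"] by (cases "mat_inverse (dft_mat n)") auto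
  then show "dft_inv n \<in> carrier_mat n n" "dft_mat n * dft_inv n = 1\<^sub>m n"
    "dft_inv n * dft_mat n = 1\<^sub>m n"
    using mat_inverse(2)[OF dft_mat_carrier] by (auto simp: dft_inv_def)
qed

definition frontal_slice :: "'a tensor \<Rightarrow> nat list \<Rightarrow> 'a mat" where
  "frontal_slice X js = mat (mode_size X 1) (mode_size X 2) (\<lambda>(i, j). entry X (i # j # js))"

text \<open>In \<open>facewise\<close> and \<open>hprod\<close> the arguments have sizes \<open>n\<^sub>1 \<times> l \<times> n\<^sub>3 \<times> \<dots> \<times> n\<^sub>k\<close> and
  \<open>l \<times> n\<^sub>2 \<times> n\<^sub>3 \<times> \<dots> \<times> n\<^sub>k\<close>.\<close>

definition facewise :: "complex tensor \<Rightarrow> complex tensor \<Rightarrow> complex tensor" where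
  "facewise X Y = mk_tensor (mode_size X 1 # mode_size Y 2 # drop 2 (dims X))
     (\<lambda>js. (frontal_slice X (drop 2 js) * frontal_slice Y (drop 2 js)) $$ (js ! 0, js ! 1))"

text \<open>\<open>X \<times>\<^sub>3 M(n\<^sub>3) \<times>\<^sub>4 \<dots> \<times>\<^sub>k M(n\<^sub>k)\<close> for a family of matrices \<open>M\<close>.\<close>

definition trailing_modes :: "(nat \<Rightarrow> complex mat) \<Rightarrow> complex tensor \<Rightarrow> complex tensor" where
  "trailing_modes M X =
     fold (\<lambda>p Y. mode_prod Y p (M (mode_size X p))) [3..<Suc (tensor_order X)] X"

definition hprod :: "complex tensor \<Rightarrow> complex tensor \<Rightarrow> complex tensor" (infixl \<open>\<star>\<^sub>H\<close> 70) where
  "T \<star>\<^sub>H S =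
     trailing_modes dft_inv (facewise (trailing_modes dft_mat T) (trailing_modes dft_mat S))"

text \<open>\<open>is_ttd r C X\<close>: the tensor \<open>X\<close> is in tensor train format with (not necessarily
  minimal) TT-ranks \<open>r 0, \<dots>, r k\<close> and cores \<open>C 1, \<dots>, C k\<close>, where \<open>k\<close> is its order.\<close>

definition is_ttd :: "(nat \<Rightarrow> nat) \<Rightarrow> (nat \<Rightarrow> complex tensor) \<Rightarrow> complex tensor \<Rightarrow> bool" where
  "is_ttd r C X \<longleftrightarrow>
     r 0 = 1 \<and> r (tensor_order X) = 1 \<and>
     (\<forall>t\<in>{1..tensor_order X}. dims (C t) = [r (t - 1), mode_size X t, r t]) \<and>
     (\<forall>js\<in>index_set (dims X).
        entry X js = (\<Sum>\<alpha>\<in>(\<Pi>\<^sub>E t\<in>{0..tensor_order X}. {..<r t}).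
          \<Prod>t=1..tensor_order X. entry (C t) [\<alpha> (t - 1), js ! (t - 1), \<alpha> t]))"

text \<open>In 1-based indexing this is \<open>\<alpha> + (\<beta> - 1) r\<^sub>t\<close>.\<close>

definition phi :: "(nat \<Rightarrow> nat) \<Rightarrow> nat \<Rightarrow> nat \<Rightarrow> nat \<Rightarrow> nat" where
  "phi r t a b = a + b * r t"

end

theory Submission
  imports Defs
begin

text \<open>A mode-\<open>p\<close> product is linear in the \<open>p\<close>-th index, and in a tensor train that index
  occurs in the \<open>p\<close>-th core only. So multiplying a tensor train by a matrix along mode \<open>p\<close>
  multiplies the \<open>p\<close>-th core along its middle mode and leaves the other cores and all ranks
  alone (\<open>ttd_mode_prod\<close>, iterated over the modes \<open>3, \<dots>, k\<close> in \<open>ttd_trailing_modes\<close>). Both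
  Fourier transforms in \<open>T \<star>\<^sub>H S\<close> are therefore moved into the cores.

  What remains is the facewise product of two tensor trains (\<open>ttd_facewise\<close>). Its entry at
  \<open>(i, j, j\<^sub>3, \<dots>, j\<^sub>k)\<close> is a sum over the contracted index \<open>m\<close> of a product of two train sums.
  Multiplied out, this is a sum over pairs \<open>(\<alpha>, \<beta>)\<close> of rank indices. From position 3 on, both
  trains are evaluated at the same \<open>j\<^sub>t\<close>, so the factors combine position by position. The index
  \<open>m\<close> occurs in just two factors, the second core of the left train and the first core of the
  right one; placing both, together with the second core of the right train, at position 2
  makes the sum over \<open>m\<close> internal to one core. The encoding \<open>phi\<close> is a bijection
  between pairs \<open>(\<alpha>\<^sub>t, \<beta>\<^sub>t)\<close> and single indices below \<open>r\<^sub>t s\<^sub>t\<close>, hence it turns the sum over pairs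
  into one train sum (\<open>sum_over_phi\<close>).\<close>

section \<open>Index sets and mode products\<close>

lemma index_set_Cons:
  "j # js \<in> index_set (d # ds) \<longleftrightarrow> j < d \<and> js \<in> index_set ds"
  by (auto simp: index_set_def nth_Cons split: nat.splits)

lemma index_set_Nil: "js \<in> index_set [] \<longleftrightarrow> js = []"
  by (simp add: index_set_def)

lemma dims_mode_prod: "dims (mode_prod X p A) = (dims X)[p - 1 := dim_row A]"
  by (simp add: mode_prod_def)

lemma index_set_update:
  assumes "js \<in> index_set (ds[i := d])" and "j < ds ! i"
  shows "js[i := j] \<in> index_set ds"
proof -
  have "js[i := j] ! m < ds ! m" if "m < length ds" for m
    using assms that by (cases "m = i") (force simp: index_set_def)+
  then show ?thesis
    using assms by (simp add: index_set_def)
qed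

text \<open>The sum over the multiplied index moves through the sum over the rank indices and past
  every factor but that of the \<open>p\<close>-th core. It is the second mode of each core that carries the
  tensor index, so that core is multiplied along mode 2, whatever \<open>p\<close> is.\<close>

lemma ttd_mode_prod:
  assumes X: "is_ttd r C X" and p: "p \<in> {1..tensor_order X}"
  shows "is_ttd r (C(p := mode_prod (C p) 2 A)) (mode_prod X p A)"
proof -
  let ?k = "tensor_order X" and ?C = "C(p := mode_prod (C p) 2 A)"
  let ?I = "\<Pi>\<^sub>E t\<in>{0..?k}. {..<r t}"
  have k: "tensor_order (mode_prod X p A) = ?k"
    by (simp add: tensor_order_def dims_mode_prod)
  have dC: "dims (C t) = [r (t - 1), mode_size X t, r t]" if "t \<in> {1..?k}" for t
    using X that by (simp add: is_ttd_def)
  have dC': "dims (?C t) = [r (t - 1), mode_size (mode_prod X p A) t, r t]" if "t \<in> {1..?k}" for t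
    using dC[OF that] that p
    by (auto simp: dims_mode_prod mode_size_def nth_list_update tensor_order_def)
  have "entry (mode_prod X p A) js =
      (\<Sum>\<alpha>\<in>?I. \<Prod>t=1..?k. entry (?C t) [\<alpha> (t - 1), js ! (t - 1), \<alpha> t])"
    if js: "js \<in> index_set (dims (mode_prod X p A))" for js
  proof -
    have len: "length js = ?k"
      using js by (simp add: index_set_def dims_mode_prod tensor_order_def)
    have p1: "p - 1 < length (dims X)" using p by (auto simp: tensor_order_def)
    then have jp: "js ! (p - 1) < dim_row A"
      using js by (fastforce simp: index_set_def dims_mode_prod)
    have upd: "js[p - 1 := j] \<in> index_set (dims X)" if "j < mode_size X p" for j
      using js that by (intro index_set_update[where d = "dim_row A"])
        (simp_all add: dims_mode_prod mode_size_def)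
    let ?rest = "\<lambda>\<alpha>. \<Prod>t\<in>{1..?k} - {p}. entry (C t) [\<alpha> (t - 1), js ! (t - 1), \<alpha> t]"
    have "entry (mode_prod X p A) js =
        (\<Sum>j<mode_size X p. A $$ (js ! (p - 1), j) * entry X (js[p - 1 := j]))"
      using js by (simp add: mode_prod_def)
    also have "\<dots> = (\<Sum>j<mode_size X p. \<Sum>\<alpha>\<in>?I.
        A $$ (js ! (p - 1), j) * (entry (C p) [\<alpha> (p - 1), j, \<alpha> p] * ?rest \<alpha>))"
    proof (rule sum.cong[OF refl])
      fix j assume "j \<in> {..<mode_size X p}"
      then have "entry X (js[p - 1 := j]) = (\<Sum>\<alpha>\<in>?I.
          \<Prod>t=1..?k. entry (C t) [\<alpha> (t - 1), js[p - 1 := j] ! (t - 1), \<alpha> t])"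
        using X upd by (simp add: is_ttd_def)
      also have "\<dots> = (\<Sum>\<alpha>\<in>?I. entry (C p) [\<alpha> (p - 1), j, \<alpha> p] * ?rest \<alpha>)"
      proof (rule sum.cong[OF refl])
        fix \<alpha>
        have "(\<Prod>t=1..?k. entry (C t) [\<alpha> (t - 1), js[p - 1 := j] ! (t - 1), \<alpha> t]) =
          entry (C p) [\<alpha> (p - 1), js[p - 1 := j] ! (p - 1), \<alpha> p] *
          (\<Prod>t\<in>{1..?k} - {p}. entry (C t) [\<alpha> (t - 1), js[p - 1 := j] ! (t - 1), \<alpha> t])"
          using p by (intro prod.remove) auto
        also have "(\<Prod>t\<in>{1..?k} - {p}. entry (C t) [\<alpha> (t - 1), js[p - 1 := j] ! (t - 1), \<alpha> t]) =
          ?rest \<alpha>"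
          using p by (intro prod.cong[OF refl]) (auto simp: nth_list_update)
        finally show "(\<Prod>t=1..?k. entry (C t) [\<alpha> (t - 1), js[p - 1 := j] ! (t - 1), \<alpha> t]) =
          entry (C p) [\<alpha> (p - 1), j, \<alpha> p] * ?rest \<alpha>"
          using p1 len by (simp only: tensor_order_def nth_list_update_eq)
      qed
      finally show "A $$ (js ! (p - 1), j) * entry X (js[p - 1 := j]) = (\<Sum>\<alpha>\<in>?I.
        A $$ (js ! (p - 1), j) * (entry (C p) [\<alpha> (p - 1), j, \<alpha> p] * ?rest \<alpha>))"
        by (simp add: sum_distrib_left)
    qed
    \<comment> \<open>The product over the other cores is independent of \<open>j\<close>.\<close>
    also have "\<dots> = (\<Sum>\<alpha>\<in>?I.
        (\<Sum>j<mode_size X p. A $$ (js ! (p - 1), j) * entry (C p) [\<alpha> (p - 1), j, \<alpha> p]) * ?rest \<alpha>)"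
      by (subst sum.swap) (simp add: sum_distrib_right mult.assoc)
    also have "\<dots> = (\<Sum>\<alpha>\<in>?I. \<Prod>t=1..?k. entry (?C t) [\<alpha> (t - 1), js ! (t - 1), \<alpha> t])"
    proof (rule sum.cong[OF refl])
      fix \<alpha> assume \<alpha>: "\<alpha> \<in> ?I"
      have "\<alpha> (p - 1) < r (p - 1)" "\<alpha> p < r p"
        using PiE_mem[OF \<alpha>, of "p - 1"] PiE_mem[OF \<alpha>, of p] p by auto
      then have "entry (?C p) [\<alpha> (p - 1), js ! (p - 1), \<alpha> p] =
          (\<Sum>j<mode_size X p. A $$ (js ! (p - 1), j) * entry (C p) [\<alpha> (p - 1), j, \<alpha> p])"
        using dC[OF p] jp
        by (simp add: mode_prod_def mode_size_def index_set_Cons index_set_Nil)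
      moreover have "(\<Prod>t\<in>{1..?k} - {p}. entry (?C t) [\<alpha> (t - 1), js ! (t - 1), \<alpha> t]) = ?rest \<alpha>"
        by (rule prod.cong) auto
      moreover have "(\<Prod>t=1..?k. entry (?C t) [\<alpha> (t - 1), js ! (t - 1), \<alpha> t]) =
          entry (?C p) [\<alpha> (p - 1), js ! (p - 1), \<alpha> p] *
          (\<Prod>t\<in>{1..?k} - {p}. entry (?C t) [\<alpha> (t - 1), js ! (t - 1), \<alpha> t])"
        using p by (intro prod.remove) auto
      ultimately show "(\<Sum>j<mode_size X p. A $$ (js ! (p - 1), j) *
            entry (C p) [\<alpha> (p - 1), j, \<alpha> p]) * ?rest \<alpha> =
          (\<Prod>t=1..?k. entry (?C t) [\<alpha> (t - 1), js ! (t - 1), \<alpha> t])"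
        by simp
    qed
    finally show ?thesis .
  qed
  then show ?thesis
    using X dC' unfolding is_ttd_def k by blast
qed

text \<open>The matrices are chosen from the sizes of the original \<open>X\<close>. Since they are square, no
  mode product changes the sizes, and the successive modes meet pairwise different cores.\<close>

lemma ttd_trailing_modes:
  assumes X: "is_ttd r C X" and M: "\<And>m. M m \<in> carrier_mat m m"
  shows "dims (trailing_modes M X) = dims X \<and>
    is_ttd r (\<lambda>t. if t \<in> {3..tensor_order X} then mode_prod (C t) 2 (M (mode_size X t)) else C t)
      (trailing_modes M X)"
proof -
  let ?k = "tensor_order X"
  let ?Y = "\<lambda>q. fold (\<lambda>p Y. mode_prod Y p (M (mode_size X p))) [3..<q] X"
  let ?C = "\<lambda>q t. if t \<in> {3..<q} then mode_prod (C t) 2 (M (mode_size X t)) else C t"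
  have "q \<le> Suc ?k \<Longrightarrow> dims (?Y q) = dims X \<and> is_ttd r (?C q) (?Y q)" for q
  proof (induction q)
    case 0
    then show ?case using X by simp
  next
    case (Suc q)
    show ?case
    proof (cases "3 \<le> q")
      case False
      then show ?thesis using X by simp
    next
      case True
      let ?A = "M (mode_size X q)"
      have d: "dims (?Y q) = dims X" and ttd: "is_ttd r (?C q) (?Y q)"
        using Suc by simp_all
      have Y: "?Y (Suc q) = mode_prod (?Y q) q ?A"
        using True by simp
      have C: "(?C q)(q := mode_prod (?C q q) 2 ?A) = ?C (Suc q)"
        using True by (auto simp: fun_eq_iff less_Suc_eq)
      have "is_ttd r ((?C q)(q := mode_prod (?C q q) 2 ?A)) (?Y (Suc q))"
        unfolding Y using True Suc.prems d by (intro ttd_mode_prod ttd) (simp add: tensor_order_def)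
      moreover have "dims (?Y (Suc q)) = dims X"
        using M[of "mode_size X q"] unfolding Y dims_mode_prod d by (simp add: mode_size_def)
      ultimately show ?thesis unfolding C by blast
    qed
  qed
  from this[of "Suc ?k"] show ?thesis
    by (simp add: trailing_modes_def atLeastLessThanSuc_atLeastAtMost)
qed

section \<open>Facewise products\<close>

text \<open>The cores of the facewise product. The rank indices arrive encoded by \<open>phi\<close>, and
  \<open>mod\<close> and \<open>div\<close> recover the two components. The first core is constant in \<open>b\<close> and \<open>b'\<close>: the first
  core of the right factor depends on the contracted index \<open>i\<close> and is deferred to the second
  position, where its right rank index is \<open>b\<close> and its left one, running up to \<open>s 0 = 1\<close>, is 0.
  The middle size is taken from \<open>H\<close> at position 2, as the facewise product has the column size
  of its right factor.\<close>

definition product_core ::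
  "(nat \<Rightarrow> nat) \<Rightarrow> (nat \<Rightarrow> nat) \<Rightarrow> (nat \<Rightarrow> complex tensor) \<Rightarrow> (nat \<Rightarrow> complex tensor) \<Rightarrow>
    nat \<Rightarrow> complex tensor" where
  "product_core r s G H t = mk_tensor
     [r (t - 1) * s (t - 1), mode_size (if t = 2 then H t else G t) 2, r t * s t]
     (\<lambda>js. let a = js ! 0 mod r (t - 1); b = js ! 0 div r (t - 1); j = js ! 1;
                a' = js ! 2 mod r t; b' = js ! 2 div r t
        in if t = 1 then entry (G 1) [a, j, a']
           else if t = 2 then
             \<Sum>i<mode_size (G 2) 2. entry (G 2) [a, i, a'] * entry (H 1) [0, i, b] * entry (H 2) [b, j, b']
           else entry (G t) [a, j, a'] * entry (H t) [b, j, b'])"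

lemma phi_decode:
  assumes "a < r t"
  shows "phi r t a b mod r t = a" and "phi r t a b div r t = b"
  using assms by (simp_all add: phi_def)

lemma phi_encode: "phi r t (c mod r t) (c div r t) = c"
  by (simp add: phi_def)

lemma phi_less:
  assumes "a < r t" and "b < s t"
  shows "phi r t a b < r t * s t"
proof -
  have "a + b * r t < Suc b * r t" using assms by simp
  also have "\<dots> \<le> s t * r t" using assms by (intro mult_right_mono) auto
  finally show ?thesis by (simp add: phi_def mult.commute)
qed

lemma decode_less:
  fixes c :: nat
  assumes "c < r t * s t"
  shows "c mod r t < r t" and "c div r t < s t"
proof -
  have "r t > 0" using assms by (cases "r t") auto
  then show "c mod r t < r t" "c div r t < s t"
    using assms by (simp_all add: less_mult_imp_div_less mult.commute)
qed

lemma entry_product_core: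
  assumes "a < r (t - 1)" "b < s (t - 1)" "a' < r t" "b' < s t"
    and "j < mode_size (if t = 2 then H t else G t) 2"
  shows "entry (product_core r s G H t) [phi r (t - 1) a b, j, phi r t a' b'] =
    (if t = 1 then entry (G 1) [a, j, a']
     else if t = 2 then
       \<Sum>i<mode_size (G 2) 2. entry (G 2) [a, i, a'] * entry (H 1) [0, i, b] * entry (H 2) [b, j, b']
     else entry (G t) [a, j, a'] * entry (H t) [b, j, b'])"
  using assms unfolding product_core_def
  by (subst entry_mk_tensor)
    (auto simp: index_set_Cons index_set_Nil phi_less phi_decode Let_def simp del: One_nat_def)

text \<open>The identification of pairs with encoded indices, applied at every position of a family
  at once; it collects the double sum over the rank indices of two trains into the single sum of
  their product.\<close>

lemma sum_over_phi:
  fixes f :: "(nat \<Rightarrow> nat) \<Rightarrow> 'a::comm_monoid_add"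
  shows "(\<Sum>\<gamma>\<in>(\<Pi>\<^sub>E t\<in>I. {..<r t * s t}). f \<gamma>) =
    (\<Sum>\<alpha>\<in>(\<Pi>\<^sub>E t\<in>I. {..<r t}). \<Sum>\<beta>\<in>(\<Pi>\<^sub>E t\<in>I. {..<s t}). f (\<lambda>t\<in>I. phi r t (\<alpha> t) (\<beta> t)))"
proof -
  have "(\<Sum>\<gamma>\<in>(\<Pi>\<^sub>E t\<in>I. {..<r t * s t}). f \<gamma>) =
    (\<Sum>(\<alpha>, \<beta>)\<in>(\<Pi>\<^sub>E t\<in>I. {..<r t}) \<times> (\<Pi>\<^sub>E t\<in>I. {..<s t}). f (\<lambda>t\<in>I. phi r t (\<alpha> t) (\<beta> t)))"
  proof (rule sum.reindex_bij_witness[where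
        i = "\<lambda>(\<alpha>, \<beta>). \<lambda>t\<in>I. phi r t (\<alpha> t) (\<beta> t)" and
        j = "\<lambda>\<gamma>. (\<lambda>t\<in>I. \<gamma> t mod r t, \<lambda>t\<in>I. \<gamma> t div r t)"], goal_cases)
    case (1 \<gamma>)
    then show ?case by (auto simp: fun_eq_iff phi_encode PiE_def extensional_def)
  next
    case (2 \<gamma>)
    then show ?case by (auto simp: PiE_iff intro: decode_less)
  next
    case (3 p)
    then show ?case by (auto simp: fun_eq_iff PiE_def Pi_def extensional_def phi_decode)
  next
    case (4 p)
    then show ?case by (auto simp: PiE_iff phi_less)
  next
    case (5 \<gamma>)
    then have "(\<lambda>t\<in>I. phi r t ((\<lambda>t\<in>I. \<gamma> t mod r t) t) ((\<lambda>t\<in>I. \<gamma> t div r t) t)) = \<gamma>"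
      by (auto simp: fun_eq_iff phi_encode PiE_def extensional_def)
    then show ?case by simp
  qed
  then show ?thesis by (simp add: sum.cartesian_product)
qed

text \<open>Isolates the two positions that take part in the matrix product from those where the
  trains are multiplied entrywise.\<close>

lemma prod_split_first_two:
  fixes f :: "nat \<Rightarrow> 'a::comm_monoid_mult"
  assumes "2 \<le> k"
  shows "prod f {1..k} = f 1 * (f 2 * prod f {3..k})"
proof -
  have "{1..k} = insert 1 (insert 2 {3..k})" using assms by auto
  then show ?thesis by simp
qed

text \<open>For fixed rank indices \<open>\<alpha>\<close> and \<open>\<beta>\<close>, the contracted index occurs only in the factors that
  \<open>product_core\<close> gathers at position 2, so summing over it yields exactly the product of the
  new cores at the encoded indices.\<close>

lemma ttd_facewise:
  assumes X: "is_ttd r G X" and Y: "is_ttd s H Y"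
    and dX: "dims X = n1 # l # ds" and dY: "dims Y = l # n2 # ds"
  shows "is_ttd (\<lambda>t. r t * s t) (product_core r s G H) (facewise X Y)"
proof -
  define k where "k = length ds + 2"
  let ?Z = "facewise X Y" and ?Q = "product_core r s G H"
  have dZ: "dims ?Z = n1 # n2 # ds"
    by (simp add: facewise_def dX dY mode_size_def)
  have ord: "tensor_order X = k" "tensor_order Y = k" "tensor_order ?Z = k" and k: "k \<ge> 2"
    by (simp_all add: tensor_order_def dX dY dZ k_def)
  have r: "r 0 = 1" "r k = 1" and s: "s 0 = 1" "s k = 1"
    using X Y by (simp_all add: is_ttd_def ord)
  have dG: "dims (G t) = [r (t - 1), mode_size X t, r t]"
    and dH: "dims (H t) = [s (t - 1), mode_size Y t, s t]" if "t \<in> {1..k}" for t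
    using X Y that by (simp_all add: is_ttd_def ord)
  have msize: "mode_size (if t = 2 then H t else G t) 2 = mode_size ?Z t" if "t \<in> {1..k}" for t
    using that dG[OF that] dH[OF that]
    by (auto simp: mode_size_def dX dY dZ nth_Cons split: nat.splits)
  have l: "mode_size (G 2) 2 = l"
    using dG[of 2] k by (simp add: mode_size_def dX)
  have dQ: "dims (?Q t) = [r (t - 1) * s (t - 1), mode_size ?Z t, r t * s t]" if "t \<in> {1..k}" for t
    using msize[OF that] by (simp add: product_core_def)
  let ?A = "\<Pi>\<^sub>E t\<in>{0..k}. {..<r t}" and ?B = "\<Pi>\<^sub>E t\<in>{0..k}. {..<s t}"
  have "entry ?Z js = (\<Sum>\<gamma>\<in>(\<Pi>\<^sub>E t\<in>{0..k}. {..<r t * s t}).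
      \<Prod>t=1..k. entry (?Q t) [\<gamma> (t - 1), js ! (t - 1), \<gamma> t])"
    if js: "js \<in> index_set (dims ?Z)" for js
  proof -
    obtain i j ks where ijk: "js = i # j # ks"
      using js by (auto simp: dZ index_set_def length_Suc_conv)
    have lt: "i < n1" "j < n2" "ks \<in> index_set ds"
      using js by (simp_all add: ijk dZ index_set_Cons)
    let ?g = "\<lambda>\<alpha> m. entry (G 1) [\<alpha> 0, i, \<alpha> 1] * entry (G 2) [\<alpha> 1, m, \<alpha> 2]"
    let ?h = "\<lambda>\<beta> m. entry (H 1) [\<beta> 0, m, \<beta> 1] * entry (H 2) [\<beta> 1, j, \<beta> 2]"
    let ?gs = "\<lambda>\<alpha>. \<Prod>t=3..k. entry (G t) [\<alpha> (t - 1), js ! (t - 1), \<alpha> t]"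
    let ?hs = "\<lambda>\<beta>. \<Prod>t=3..k. entry (H t) [\<beta> (t - 1), js ! (t - 1), \<beta> t]"
    have tail: "(i' # j' # ks) ! (t - 1) = js ! (t - 1)" if "t \<in> {3..k}" for t i' j'
      using that by (auto simp: ijk nth_Cons split: nat.splits)
    have eX: "entry X (i # m # ks) = (\<Sum>\<alpha>\<in>?A. ?g \<alpha> m * ?gs \<alpha>)" if "m < l" for m
    proof -
      have "entry X (i # m # ks) = (\<Sum>\<alpha>\<in>?A.
          \<Prod>t=1..k. entry (G t) [\<alpha> (t - 1), (i # m # ks) ! (t - 1), \<alpha> t])"
        using X that lt by (simp add: is_ttd_def ord dX index_set_Cons)
      also have "\<dots> = (\<Sum>\<alpha>\<in>?A. ?g \<alpha> m * ?gs \<alpha>)"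
        unfolding prod_split_first_two[OF k] mult.assoc
        by (intro sum.cong[OF refl] arg_cong2[where f = "(*)"] prod.cong) (simp_all only: tail, simp_all)
      finally show ?thesis .
    qed
    have eY: "entry Y (m # j # ks) = (\<Sum>\<beta>\<in>?B. ?h \<beta> m * ?hs \<beta>)" if "m < l" for m
    proof -
      have "entry Y (m # j # ks) = (\<Sum>\<beta>\<in>?B.
          \<Prod>t=1..k. entry (H t) [\<beta> (t - 1), (m # j # ks) ! (t - 1), \<beta> t])"
        using Y that lt by (simp add: is_ttd_def ord dY index_set_Cons)
      also have "\<dots> = (\<Sum>\<beta>\<in>?B. ?h \<beta> m * ?hs \<beta>)"
        unfolding prod_split_first_two[OF k] mult.assoc
        by (intro sum.cong[OF refl] arg_cong2[where f = "(*)"] prod.cong) (simp_all only: tail, simp_all)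
      finally show ?thesis .
    qed
    have core: "(\<Sum>m<l. (?g \<alpha> m * ?gs \<alpha>) * (?h \<beta> m * ?hs \<beta>)) =
        (\<Prod>t=1..k. entry (?Q t) [(\<lambda>t\<in>{0..k}. phi r t (\<alpha> t) (\<beta> t)) (t - 1), js ! (t - 1),
          (\<lambda>t\<in>{0..k}. phi r t (\<alpha> t) (\<beta> t)) t])"
      if \<alpha>: "\<alpha> \<in> ?A" and \<beta>: "\<beta> \<in> ?B" for \<alpha> \<beta>
    proof -
      have a: "\<alpha> t < r t" and b: "\<beta> t < s t" if "t \<le> k" for t
        using PiE_mem[OF \<alpha>, of t] PiE_mem[OF \<beta>, of t] that by auto
      \<comment> \<open>The left rank index of the first core of \<open>Y\<close> is not encoded at position 2, where that
        core now stands; this fact lets it be read as the constant 0.\<close>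
      have \<beta>0: "\<beta> 0 = 0" using b[of 0] s by simp
      have Q: "entry (?Q t) [(\<lambda>t\<in>{0..k}. phi r t (\<alpha> t) (\<beta> t)) (t - 1), js ! (t - 1),
            (\<lambda>t\<in>{0..k}. phi r t (\<alpha> t) (\<beta> t)) t] =
          (if t = 1 then entry (G 1) [\<alpha> (t - 1), js ! (t - 1), \<alpha> t]
           else if t = 2 then \<Sum>m<l. entry (G 2) [\<alpha> (t - 1), m, \<alpha> t] *
             entry (H 1) [0, m, \<beta> (t - 1)] * entry (H 2) [\<beta> (t - 1), js ! (t - 1), \<beta> t]
           else entry (G t) [\<alpha> (t - 1), js ! (t - 1), \<alpha> t] *
             entry (H t) [\<beta> (t - 1), js ! (t - 1), \<beta> t])" if t: "t \<in> {1..k}" for t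
      proof -
        have "js ! (t - 1) < mode_size (if t = 2 then H t else G t) 2"
          unfolding msize[OF t] using js t by (auto simp: index_set_def mode_size_def dZ k_def)
        moreover have "(\<lambda>t\<in>{0..k}. phi r t (\<alpha> t) (\<beta> t)) (t - 1) =
            phi r (t - 1) (\<alpha> (t - 1)) (\<beta> (t - 1))"
          "(\<lambda>t\<in>{0..k}. phi r t (\<alpha> t) (\<beta> t)) t = phi r t (\<alpha> t) (\<beta> t)"
          using t by auto
        moreover have "t - 1 \<le> k" "t \<le> k" using t by auto
        ultimately show ?thesis
          using a[of "t - 1"] a[of t] b[of "t - 1"] b[of t]
          by (simp only: l[symmetric]) (rule entry_product_core; simp)
      qed
      have "(\<Prod>t=1..k. entry (?Q t) [(\<lambda>t\<in>{0..k}. phi r t (\<alpha> t) (\<beta> t)) (t - 1), js ! (t - 1),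
            (\<lambda>t\<in>{0..k}. phi r t (\<alpha> t) (\<beta> t)) t]) =
          (\<Prod>t=1..k. (if t = 1 then entry (G 1) [\<alpha> (t - 1), js ! (t - 1), \<alpha> t]
           else if t = 2 then \<Sum>m<l. entry (G 2) [\<alpha> (t - 1), m, \<alpha> t] *
             entry (H 1) [0, m, \<beta> (t - 1)] * entry (H 2) [\<beta> (t - 1), js ! (t - 1), \<beta> t]
           else entry (G t) [\<alpha> (t - 1), js ! (t - 1), \<alpha> t] *
             entry (H t) [\<beta> (t - 1), js ! (t - 1), \<beta> t]))"
        using Q by (rule prod.cong[OF refl])
      also have "\<dots> = entry (G 1) [\<alpha> 0, i, \<alpha> 1] *
          ((\<Sum>m<l. entry (G 2) [\<alpha> 1, m, \<alpha> 2] * entry (H 1) [0, m, \<beta> 1] *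
             entry (H 2) [\<beta> 1, j, \<beta> 2]) * (?gs \<alpha> * ?hs \<beta>))"
        unfolding prod_split_first_two[OF k] prod.distrib[symmetric]
        by (intro arg_cong2[where f = "(*)"] prod.cong) (auto simp: ijk)
      also have "\<dots> = (\<Sum>m<l. (?g \<alpha> m * ?gs \<alpha>) * (?h \<beta> m * ?hs \<beta>))"
        unfolding \<beta>0 sum_distrib_left sum_distrib_right
        by (rule sum.cong[OF refl]) (simp only: ac_simps)
      finally show ?thesis by simp
    qed
    have "entry ?Z js = (\<Sum>m<l. entry X (i # m # ks) * entry Y (m # j # ks))"
      using js lt
      by (simp add: facewise_def dX dY mode_size_def frontal_slice_def ijk index_set_Cons
          scalar_prod_def atLeast0LessThan)
    also have "\<dots> = (\<Sum>m<l. (\<Sum>\<alpha>\<in>?A. ?g \<alpha> m * ?gs \<alpha>) * (\<Sum>\<beta>\<in>?B. ?h \<beta> m * ?hs \<beta>))"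
      by (rule sum.cong[OF refl]) (simp only: eX eY lessThan_iff)
    also have "\<dots> = (\<Sum>m<l. \<Sum>\<alpha>\<in>?A. \<Sum>\<beta>\<in>?B. (?g \<alpha> m * ?gs \<alpha>) * (?h \<beta> m * ?hs \<beta>))"
      by (simp only: sum_product)
    also have "\<dots> = (\<Sum>\<alpha>\<in>?A. \<Sum>m<l. \<Sum>\<beta>\<in>?B. (?g \<alpha> m * ?gs \<alpha>) * (?h \<beta> m * ?hs \<beta>))"
      by (rule sum.swap)
    also have "\<dots> = (\<Sum>\<alpha>\<in>?A. \<Sum>\<beta>\<in>?B. \<Sum>m<l. (?g \<alpha> m * ?gs \<alpha>) * (?h \<beta> m * ?hs \<beta>))"
      by (intro sum.cong[OF refl] sum.swap)
    also have "\<dots> = (\<Sum>\<alpha>\<in>?A. \<Sum>\<beta>\<in>?B. \<Prod>t=1..k.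
        entry (?Q t) [(\<lambda>t\<in>{0..k}. phi r t (\<alpha> t) (\<beta> t)) (t - 1), js ! (t - 1),
          (\<lambda>t\<in>{0..k}. phi r t (\<alpha> t) (\<beta> t)) t])"
      by (intro sum.cong[OF refl] core)
    also have "\<dots> = (\<Sum>\<gamma>\<in>(\<Pi>\<^sub>E t\<in>{0..k}. {..<r t * s t}).
        \<Prod>t=1..k. entry (?Q t) [\<gamma> (t - 1), js ! (t - 1), \<gamma> t])"
      by (rule sum_over_phi[symmetric])
    finally show ?thesis .
  qed
  then show ?thesis
    using r s dQ unfolding is_ttd_def ord by simp
qed

section \<open>The product of two tensor trains\<close>

theorem proposition4p3:
  fixes k l :: nat and n r s :: "nat \<Rightarrow> nat"
    and T S :: "complex tensor" and G H :: "nat \<Rightarrow> complex tensor"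
  assumes "k \<ge> 3"
    and "dims T = [n 1, l] @ map n [3..<Suc k]"
    and "dims S = [l, n 2] @ map n [3..<Suc k]"
    and "\<forall>js\<in>index_set (dims T). entry T js \<in> \<real>"
    and "\<forall>js\<in>index_set (dims S). entry S js \<in> \<real>"
    and "is_ttd r G T"
    and "is_ttd s H S"
  shows "\<exists>P P'.
    is_ttd (\<lambda>t. r t * s t) P (T \<star>\<^sub>H S) \<and>
    (\<forall>j1<n 1. \<forall>a1<r 1. \<forall>b1<s 1.
       entry (P 1) [0, j1, phi r 1 a1 b1] = entry (G 1) [0, j1, a1]) \<and>
    (\<forall>a1<r 1. \<forall>b1<s 1. \<forall>j2<n 2. \<forall>a2<r 2. \<forall>b2<s 2.
       entry (P 2) [phi r 1 a1 b1, j2, phi r 2 a2 b2] =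
         (\<Sum>j<l. entry (G 2) [a1, j, a2] * entry (H 1) [0, j, b1] * entry (H 2) [b1, j2, b2])) \<and>
    (\<forall>t\<in>{3..k}.
       P t = mode_prod (P' t) 2 (dft_inv (n t)) \<and>
       dims (P' t) = [r (t - 1) * s (t - 1), n t, r t * s t] \<and>
       (\<forall>a<r (t - 1). \<forall>b<s (t - 1). \<forall>j<n t. \<forall>a'<r t. \<forall>b'<s t.
          entry (P' t) [phi r (t - 1) a b, j, phi r t a' b'] =
            entry (mode_prod (G t) 2 (dft_mat (n t))) [a, j, a'] *
            entry (mode_prod (H t) 2 (dft_mat (n t))) [b, j, b']))"
proof -
  define G' where "G' = (\<lambda>t. if t \<in> {3..k} then mode_prod (G t) 2 (dft_mat (n t)) else G t)"
  define H' where "H' = (\<lambda>t. if t \<in> {3..k} then mode_prod (H t) 2 (dft_mat (n t)) else H t)"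
  define P' where "P' = product_core r s G' H'"
  define P where "P = (\<lambda>t. if t \<in> {3..k} then mode_prod (P' t) 2 (dft_inv (n t)) else P' t)"
  let ?ns = "map n [3..<Suc k]"
  let ?TF = "trailing_modes dft_mat T" and ?SF = "trailing_modes dft_mat S"
  let ?Z = "facewise ?TF ?SF"
  have k: "tensor_order X = k" if "dims X = m # m' # ?ns" for X :: "complex tensor" and m m'
    using that assms(1) by (simp add: tensor_order_def)
  have size: "mode_size X t = n t" if "dims X = m # m' # ?ns" "t \<in> {3..k}"
    for X :: "complex tensor" and m m' t
  proof -
    have "t - 1 = Suc (Suc (t - 3))" "t - 3 < length [3..<Suc k]" using that by auto
    then show ?thesis using that(2) by (simp add: mode_size_def that(1) del: upt_Suc)
  qed
  have dT: "dims T = n 1 # l # ?ns" and dS: "dims S = l # n 2 # ?ns"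
    using assms(2,3) by simp_all
  have core_T: "(if t \<in> {3..tensor_order T} then mode_prod (G t) 2 (dft_mat (mode_size T t)) else G t) = G' t"
    for t using size[OF dT] by (simp add: G'_def k[OF dT])
  have core_S: "(if t \<in> {3..tensor_order S} then mode_prod (H t) 2 (dft_mat (mode_size S t)) else H t) = H' t"
    for t using size[OF dS] by (simp add: H'_def k[OF dS])
  have TF: "dims ?TF = n 1 # l # ?ns" "is_ttd r G' ?TF"
    using ttd_trailing_modes[OF assms(6), where M = dft_mat]
    unfolding core_T by (simp_all add: dT)
  have SF: "dims ?SF = l # n 2 # ?ns" "is_ttd s H' ?SF"
    using ttd_trailing_modes[OF assms(7), where M = dft_mat]
    unfolding core_S by (simp_all add: dS)
  have dZ: "dims ?Z = n 1 # n 2 # ?ns"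
    by (simp add: facewise_def TF SF mode_size_def)
  have Z: "is_ttd (\<lambda>t. r t * s t) P' ?Z"
    unfolding P'_def by (rule ttd_facewise[OF TF(2) SF(2) TF(1) SF(1)])
  have core_Z: "(if t \<in> {3..tensor_order ?Z} then mode_prod (P' t) 2 (dft_inv (mode_size ?Z t)) else P' t) = P t"
    for t using size[OF dZ] by (simp add: P_def k[OF dZ])
  have "is_ttd (\<lambda>t. r t * s t) P (T \<star>\<^sub>H S)"
    using ttd_trailing_modes[OF Z, where M = dft_inv] dft_inv(1)
    unfolding core_Z hprod_def by blast
  moreover have dG: "dims (G t) = [r (t - 1), mode_size T t, r t]"
    and dH: "dims (H t) = [s (t - 1), mode_size S t, s t]" if "t \<in> {1..k}" for t
    using assms(6,7) that by (simp_all add: is_ttd_def k[OF dT] k[OF dS])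
  have r0: "r 0 = 1" and s0: "s 0 = 1"
    using assms(6,7) by (simp_all add: is_ttd_def)
  have small: "G' 1 = G 1" "G' 2 = G 2" "H' 1 = H 1" "H' 2 = H 2" "P 1 = P' 1" "P 2 = P' 2"
    by (simp_all add: G'_def H'_def P_def)
  have sizes: "mode_size (G 1) 2 = n 1" "mode_size (G 2) 2 = l" "mode_size (H 2) 2 = n 2"
    using dG[of 1] dG[of 2] dH[of 2] assms(1) by (simp_all add: mode_size_def dT dS)
  have size': "mode_size (G' t) 2 = n t" if t: "t \<in> {3..k}" for t
    using dG[of t] size[OF dT t] t by (simp add: G'_def mode_size_def dims_mode_prod dft_mat_def)
  \<comment> \<open>As \<open>r 0 = s 0 = 1\<close>, the left index 0 of the first core encodes the pair \<open>(0, 0)\<close>.\<close>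
  have "entry (P 1) [0, j1, phi r 1 a1 b1] = entry (G 1) [0, j1, a1]"
    if "j1 < n 1" "a1 < r 1" "b1 < s 1" for j1 a1 b1
    using entry_product_core[of 0 r 1 0 s a1 b1 j1 H' G'] that
    unfolding small P'_def by (simp add: small sizes r0 s0 phi_def del: One_nat_def)
  moreover have "entry (P 2) [phi r 1 a1 b1, j2, phi r 2 a2 b2] =
      (\<Sum>j<l. entry (G 2) [a1, j, a2] * entry (H 1) [0, j, b1] * entry (H 2) [b1, j2, b2])"
    if "a1 < r 1" "b1 < s 1" "j2 < n 2" "a2 < r 2" "b2 < s 2" for a1 b1 j2 a2 b2
    using entry_product_core[of a1 r 2 b1 s a2 b2 j2 H' G'] that
    unfolding small P'_def by (simp add: small[unfolded One_nat_def] sizes)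
  moreover have "P t = mode_prod (P' t) 2 (dft_inv (n t)) \<and>
      dims (P' t) = [r (t - 1) * s (t - 1), n t, r t * s t] \<and>
      (\<forall>a<r (t - 1). \<forall>b<s (t - 1). \<forall>j<n t. \<forall>a'<r t. \<forall>b'<s t.
        entry (P' t) [phi r (t - 1) a b, j, phi r t a' b'] =
          entry (mode_prod (G t) 2 (dft_mat (n t))) [a, j, a'] *
          entry (mode_prod (H t) 2 (dft_mat (n t))) [b, j, b'])" if t: "t \<in> {3..k}" for t
  proof (intro conjI allI impI)
    show "P t = mode_prod (P' t) 2 (dft_inv (n t))"
      using t by (simp add: P_def)
    show "dims (P' t) = [r (t - 1) * s (t - 1), n t, r t * s t]"
      using t size'[OF t] by (simp add: P'_def product_core_def)
    fix a b j a' b'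
    assume *: "a < r (t - 1)" "b < s (t - 1)" "j < n t" "a' < r t" "b' < s t"
    have "G' t = mode_prod (G t) 2 (dft_mat (n t))" "H' t = mode_prod (H t) 2 (dft_mat (n t))"
      using t by (simp_all add: G'_def H'_def)
    then show "entry (P' t) [phi r (t - 1) a b, j, phi r t a' b'] =
          entry (mode_prod (G t) 2 (dft_mat (n t))) [a, j, a'] *
          entry (mode_prod (H t) 2 (dft_mat (n t))) [b, j, b']"
      using entry_product_core[of a r t b s a' b' j H' G'] * t size'[OF t]
      by (simp add: P'_def)
  qed
  ultimately show ?thesis
    by (intro exI[of _ P] exI[of _ P']) blast
qed


end
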